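(* Let $C\subseteq\mathbb{F}_q^n$ be an $[n,k]$ code over $\mathbb{F}_q$, let $T\subseteq[n]$, and let $r\ge0$ be an integer. Then $$J_{C,T}^{(r)}(w,z,x,y)=\sum_{s=0}^{n-|T|}\sum_{t=0}^{|T|}Q_{s,t}^{(r)}(C;T)\,(w-z)^{t}z^{|T|-t}(x-y)^{s}y^{n-|T|-s}.$$
   Context: $q$ is a prime power, $[n]=\{1,\dots,n\}$, $\overline{T}=[n]\setminus T$, and $\binom{S}{s}$ denotes the set of $s$-subsets of a set $S$. An $[n,k]$ code over $\mathbb{F}_q$ is a $k$-dimensional $\mathbb{F}_q$-linear subspace $C$ of $\mathbb{F}_q^n$. For a linear subspace $D\subseteq\mathbb{F}_q^n$, $\mathrm{Supp}(D)=\{i\in[n] : u_i\ne 0\text{ for some }u\in D\}$ and $\mathrm{wt}_S(D)=|\mathrm{Supp}(D)\cap S|$ for $S\subseteq[n]$. $\mathcal{D}_r(C)$ is the set of $r$-dimensional $\mathbb{F}_q$-subspaces of $C$. The $r$-th higher Jacobi polynomial is $$J_{C,T}^{(r)}(w,z,x,y)=\sum_{i=0}^{n-|T|}\sum_{j=0}^{|T|}A_{i,j}^{(r)}(C,T)\,w^{|T|-j}z^{j}x^{n-|T|-i}y^{i},$$ where $A_{i,j}^{(r)}(C,T)=\#\{D\in\mathcal{D}_r(C) : \mathrm{wt}_{\overline{T}}(D)=i,\ \mathrm{wt}_T(D)=j\}$. For $X\subseteq\overline{T}$ and $Y\subseteq T$ put $C_T(X,Y)=\{u\in C : u_i=0\text{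 for all }i\in X\cup Y\}$ and $B_{X,Y}^{(r)}(C;T)=\#\{D\in\mathcal{D}_r(C) : D\subseteq C_T(X,Y)\}$, and set $$Q_{s,t}^{(r)}(C;T)=\sum_{X\in\binom{\overline{T}}{s}}\ \sum_{Y\in\binom{T}{t}}B_{X,Y}^{(r)}(C;T).$$ *)

theory Defs
  imports "HOL-Analysis.Cartesian_Space" "HOL-Library.Poly_Mapping"
begin

text \<open>
  The ambient space \<open>F\<^sub>q\<^sup>n\<close> is \<^typ>\<open>'a ^ 'n\<close>, where \<^typ>\<open>'a\<close> is a finite field, \<open>q = CARD('a)\<close>,
  \<open>n = CARD('n)\<close>, and the coordinate set \<open>[n]\<close> is the universe of \<^typ>\<open>'n\<close>.
\<close>

definition linear_code :: "nat \<Rightarrow> ('a::{field,finite} ^ 'n) set \<Rightarrow> bool" where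
  "linear_code k C \<longleftrightarrow> vec.subspace C \<and> vec.dim C = k"

definition supp :: "('a::{field,finite} ^ 'n) set \<Rightarrow> 'n set" where
  "supp D = {i. \<exists>u\<in>D. u $ i \<noteq> 0}"

definition wt :: "'n set \<Rightarrow> ('a::{field,finite} ^ 'n) set \<Rightarrow> nat" where
  "wt S D = card (supp D \<inter> S)"

definition subcodes :: "nat \<Rightarrow> ('a::{field,finite} ^ 'n) set \<Rightarrow> ('a ^ 'n) set set" where
  "subcodes r C = {D. vec.subspace D \<and> D \<subseteq> C \<and> vec.dim D = r}"

definition A_coeff :: "nat \<Rightarrow> ('a::{field,finite} ^ 'n) set \<Rightarrow> 'n set \<Rightarrow> nat \<Rightarrow> nat \<Rightarrow> nat" where
  "A_coeff r C T i j = card {D \<in> subcodes r C. wt (- T) D = i \<and> wt T D = j}"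

definition C_zero :: "('a::{field,finite} ^ 'n) set \<Rightarrow> 'n set \<Rightarrow> 'n set \<Rightarrow> ('a ^ 'n) set" where
  "C_zero C X Y = {u \<in> C. \<forall>i \<in> X \<union> Y. u $ i = 0}"

text \<open>
  In \<open>C\<^sub>T(X,Y)\<close> and \<open>B\<^bsub>X,Y\<^esub>(C;T)\<close> the set \<open>T\<close> only restricts the range of \<open>X\<close> and \<open>Y\<close>;
  the restriction is imposed in \<open>Q_coeff\<close>.
\<close>

definition B_coeff :: "nat \<Rightarrow> ('a::{field,finite} ^ 'n) set \<Rightarrow> 'n set \<Rightarrow> 'n set \<Rightarrow> nat" where
  "B_coeff r C X Y = card {D \<in> subcodes r C. D \<subseteq> C_zero C X Y}"

definition Q_coeff :: "nat \<Rightarrow> ('a::{field,finite} ^ 'n) set \<Rightarrow> 'n set \<Rightarrow> nat \<Rightarrow> nat \<Rightarrow> nat" where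
  "Q_coeff r C T s t =
    (\<Sum>X\<in>{X. X \<subseteq> - T \<and> card X = s}. \<Sum>Y\<in>{Y. Y \<subseteq> T \<and> card Y = t}. B_coeff r C X Y)"

text \<open>
  The polynomial ring \<open>\<int>[w,z,x,y]\<close>: a polynomial is a finitely supported map from monomials
  (finitely supported exponent vectors) to integer coefficients, multiplied by convolution.
\<close>

datatype jvar = W | Z | X | Y

type_synonym jpoly = "(jvar \<Rightarrow>\<^sub>0 nat) \<Rightarrow>\<^sub>0 int"

definition indet :: "jvar \<Rightarrow> jpoly" where
  "indet v = Poly_Mapping.single (Poly_Mapping.single v 1) 1"

abbreviation "pw \<equiv> indet W"
abbreviation "pz \<equiv> indet Z"
abbreviation "px \<equiv> indet X"
abbreviation "py \<equiv> indet Y"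

hide_const (open) W Z X Y

definition higher_jacobi :: "nat \<Rightarrow> ('a::{field,finite} ^ 'n) set \<Rightarrow> 'n set \<Rightarrow> jpoly" where
  "higher_jacobi r C T =
    (\<Sum>i=0..CARD('n) - card T. \<Sum>j=0..card T.
      of_nat (A_coeff r C T i j) * pw ^ (card T - j) * pz ^ j
        * px ^ (CARD('n) - card T - i) * py ^ i)"

end

theory Submission imports Defs begin

text \<open>
  The proof is a double count of the pairs consisting of an \<open>r\<close>-dimensional subcode \<open>D\<close> and a set
  of coordinates on which \<open>D\<close> vanishes. Both sides are sums over the subcodes \<open>D\<close>, and they agree
  term by term. On the left, \<open>D\<close> contributes a monomial in which \<open>y\<close> and \<open>x\<close> mark the coordinates
  outside \<open>T\<close> where \<open>D\<close> is supported, respectively where it vanishes, while \<open>z\<close> and \<open>w\<close> do the same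
  inside \<open>T\<close>. Writing each \<open>x\<close> as \<open>(x - y) + y\<close>, and each \<open>w\<close> as \<open>(w - z) + z\<close>, and multiplying out
  means choosing a set \<open>X\<close>, respectively \<open>Y\<close>, of coordinates at which \<open>D\<close> vanishes
  (\<open>power_mult_power_eq_sum_subsets\<close>). Since \<open>D\<close> vanishes on \<open>X \<union> Y\<close> exactly when it is contained in
  \<open>C\<^sub>T(X,Y)\<close> (\<open>subset_C_zero_iff\<close>), exchanging the sums over \<open>D\<close> and over \<open>(X, Y)\<close> turns the number
  of admissible \<open>D\<close> into \<open>B\<^bsub>X,Y\<^esub>(C;T)\<close>, and collecting the pairs \<open>(X, Y)\<close> by cardinality gives the
  coefficients \<open>Q\<^bsub>s,t\<^esub>(C;T)\<close>.
\<close>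

text \<open>
  Each of the factors \<open>x\<close>, one for every element of \<open>S\<close> outside \<open>A\<close>, is split as \<open>(x - y) + y\<close>; in
  the expanded product, \<open>X\<close> collects the elements at which \<open>x - y\<close> is chosen. The sum runs over all
  subsets of \<open>S\<close>, with a case distinction, so that its range does not depend on \<open>A\<close>: later \<open>A\<close> is the
  support of a subcode, and the sum over subcodes has to be moved inside.
\<close>

lemma power_mult_power_eq_sum_subsets:
  fixes x y :: "'b::comm_ring_1"
  assumes "finite S"
  shows "x ^ card (S - A) * y ^ card (A \<inter> S)
    = (\<Sum>X\<in>Pow S. if X \<inter> A = {} then (x - y) ^ card X * y ^ (card S - card X) else 0)"
proof -
  let ?U = "S - A"
  have fin: "finite ?U" using assms by simp
  have card_S: "card S = card ?U + card (A \<inter> S)"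
    using assms by (metis Int_commute add.commute card_Int_Diff)
  have "x ^ card ?U = (\<Prod>i\<in>?U. (x - y) + y)" by simp
  also have "\<dots> = (\<Sum>X\<in>Pow ?U. (\<Prod>i\<in>X. x - y) * (\<Prod>i\<in>?U - X. y))"
    by (rule prod_add[OF fin])
  also have "\<dots> = (\<Sum>X\<in>Pow ?U. (x - y) ^ card X * y ^ (card ?U - card X))"
    by (intro sum.cong refl) (simp add: card_Diff_subset finite_subset[OF _ fin])
  finally have "x ^ card ?U * y ^ card (A \<inter> S)
      = (\<Sum>X\<in>Pow ?U. (x - y) ^ card X * (y ^ (card ?U - card X) * y ^ card (A \<inter> S)))"
    by (simp add: sum_distrib_right mult.assoc)
  also have "\<dots> = (\<Sum>X\<in>Pow ?U. (x - y) ^ card X * y ^ (card S - card X))"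
  proof (intro sum.cong refl)
    fix X assume "X \<in> Pow ?U"
    hence "card X \<le> card ?U" using fin by (simp add: card_mono)
    thus "(x - y) ^ card X * (y ^ (card ?U - card X) * y ^ card (A \<inter> S))
        = (x - y) ^ card X * y ^ (card S - card X)"
      by (simp add: card_S flip: power_add)
  qed
  also have "\<dots> = (\<Sum>X\<in>Pow S. if X \<inter> A = {} then (x - y) ^ card X * y ^ (card S - card X) else 0)"
    using assms by (intro sum.mono_neutral_cong_left) auto
  finally show ?thesis .
qed

lemma sum_subsets_by_card:
  assumes "finite S"
  shows "(\<Sum>s=0..card S. \<Sum>X\<in>{X. X \<subseteq> S \<and> card X = s}. f X) = (\<Sum>X\<in>Pow S. f X)"
proof -
  have "(\<Sum>X\<in>Pow S. f X) = (\<Sum>s=0..card S. \<Sum>X\<in>{X \<in> Pow S. card X = s}. f X)"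
    using assms by (intro sum.group[symmetric]) (auto intro: card_mono)
  thus ?thesis by simp
qed

lemma subset_C_zero_iff:
  assumes "D \<subseteq> C"
  shows "D \<subseteq> C_zero C X Y \<longleftrightarrow> X \<inter> supp D = {} \<and> Y \<inter> supp D = {}"
  using assms unfolding C_zero_def supp_def by auto

lemma card_Compl_finite: "card (- T) = CARD('n) - card T" for T :: "'n::finite set"
  by (simp add: Compl_eq_Diff_UNIV card_Diff_subset)

lemma wt_le: "wt S D \<le> card S"
  unfolding wt_def by (simp add: card_mono)

lemma card_minus_wt: "card S - wt S D = card (S - supp D)"
  unfolding wt_def by (metis Int_commute card_Diff_subset_Int finite)

lemma higher_jacobi_eq_sum_subcodes:
  fixes C :: "('a::{field,finite} ^ 'n) set"
  shows "higher_jacobi r C T = (\<Sum>D\<in>subcodes r C.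
    (px ^ card (- T - supp D) * py ^ card (supp D \<inter> - T))
      * (pw ^ card (T - supp D) * pz ^ card (supp D \<inter> T)))"
proof -
  let ?m = "\<lambda>i j. pw ^ (card T - j) * pz ^ j * px ^ (card (- T) - i) * py ^ i"
  let ?D = "\<lambda>i j. {D \<in> subcodes r C. wt (- T) D = i \<and> wt T D = j}"
  have "higher_jacobi r C T = (\<Sum>i=0..card (- T). \<Sum>j=0..card T. of_nat (card (?D i j)) * ?m i j)"
    by (simp add: higher_jacobi_def A_coeff_def card_Compl_finite mult.assoc)
  also have "\<dots> = (\<Sum>i=0..card (- T). \<Sum>j=0..card T. \<Sum>D\<in>?D i j. ?m (wt (- T) D) (wt T D))"
    by (intro sum.cong refl) simp
  also have "\<dots> = (\<Sum>p\<in>{0..card (- T)} \<times> {0..card T}.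
      \<Sum>D\<in>{D \<in> subcodes r C. (wt (- T) D, wt T D) = p}. ?m (wt (- T) D) (wt T D))"
    unfolding sum.cartesian_product by (intro sum.cong refl) auto
  also have "\<dots> = (\<Sum>D\<in>subcodes r C. ?m (wt (- T) D) (wt T D))"
    by (rule sum.group) (auto simp: wt_le)
  finally show ?thesis
    by (simp only: card_minus_wt) (simp add: wt_def mult_ac)
qed

lemma sum_Q_coeff:
  fixes C :: "('a::{field,finite} ^ 'n) set" and f g :: "nat \<Rightarrow> 'b::comm_semiring_1"
  shows "(\<Sum>s=0..card (- T). \<Sum>t=0..card T. of_nat (Q_coeff r C T s t) * (f s * g t))
    = (\<Sum>X\<in>Pow (- T). \<Sum>Y\<in>Pow T. of_nat (B_coeff r C X Y) * (f (card X) * g (card Y)))"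
proof -
  have "(\<Sum>s=0..card (- T). \<Sum>t=0..card T. of_nat (Q_coeff r C T s t) * (f s * g t))
    = (\<Sum>s=0..card (- T). \<Sum>t=0..card T. \<Sum>X\<in>{X. X \<subseteq> - T \<and> card X = s}.
        \<Sum>Y\<in>{Y. Y \<subseteq> T \<and> card Y = t}. of_nat (B_coeff r C X Y) * (f (card X) * g (card Y)))"
    by (intro sum.cong refl) (simp add: Q_coeff_def sum_distrib_right)
  also have "\<dots> = (\<Sum>s=0..card (- T). \<Sum>X\<in>{X. X \<subseteq> - T \<and> card X = s}. \<Sum>t=0..card T.
        \<Sum>Y\<in>{Y. Y \<subseteq> T \<and> card Y = t}. of_nat (B_coeff r C X Y) * (f (card X) * g (card Y)))"
    by (intro sum.cong refl sum.swap)
  finally show ?thesis by (simp only: sum_subsets_by_card finite)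
qed

theorem theorem3p2:
  fixes C :: "('a::{field,finite} ^ 'n) set" and T :: "'n set" and k r :: nat
  assumes "linear_code k C"
  shows "higher_jacobi r C T =
    (\<Sum>s=0..CARD('n) - card T. \<Sum>t=0..card T.
      of_nat (Q_coeff r C T s t) * (pw - pz) ^ t * pz ^ (card T - t)
        * (px - py) ^ s * py ^ (CARD('n) - card T - s))"
proof -
  define f where "f s = (px - py) ^ s * py ^ (card (- T) - s)" for s
  define g where "g t = (pw - pz) ^ t * pz ^ (card T - t)" for t
  let ?h = "\<lambda>X Y. f (card X) * g (card Y)"
  have B: "(\<Sum>D\<in>subcodes r C. if X \<inter> supp D = {} \<and> Y \<inter> supp D = {} then ?h X Y else 0)
      = of_nat (B_coeff r C X Y) * ?h X Y" for X Y
  proof -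
    have "{D \<in> subcodes r C. D \<subseteq> C_zero C X Y}
        = {D \<in> subcodes r C. X \<inter> supp D = {} \<and> Y \<inter> supp D = {}}"
      by (intro Collect_cong conj_cong refl subset_C_zero_iff) (simp add: subcodes_def)
    thus ?thesis by (simp add: B_coeff_def flip: sum.inter_filter)
  qed
  have "higher_jacobi r C T = (\<Sum>D\<in>subcodes r C.
      (\<Sum>X\<in>Pow (- T). if X \<inter> supp D = {} then f (card X) else 0)
        * (\<Sum>Y\<in>Pow T. if Y \<inter> supp D = {} then g (card Y) else 0))"
    by (simp only: higher_jacobi_eq_sum_subcodes power_mult_power_eq_sum_subsets finite f_def g_def)
  also have "\<dots> = (\<Sum>D\<in>subcodes r C. \<Sum>X\<in>Pow (- T). \<Sum>Y\<in>Pow T.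
      if X \<inter> supp D = {} \<and> Y \<inter> supp D = {} then ?h X Y else 0)"
    unfolding sum_product by (intro sum.cong refl) simp
  also have "\<dots> = (\<Sum>X\<in>Pow (- T). \<Sum>D\<in>subcodes r C. \<Sum>Y\<in>Pow T.
      if X \<inter> supp D = {} \<and> Y \<inter> supp D = {} then ?h X Y else 0)"
    by (rule sum.swap)
  also have "\<dots> = (\<Sum>X\<in>Pow (- T). \<Sum>Y\<in>Pow T. \<Sum>D\<in>subcodes r C.
      if X \<inter> supp D = {} \<and> Y \<inter> supp D = {} then ?h X Y else 0)"
    by (intro sum.cong refl sum.swap)
  also have "\<dots> = (\<Sum>s=0..card (- T). \<Sum>t=0..card T. of_nat (Q_coeff r C T s t) * (f s * g t))"
    by (simp only: B sum_Q_coeff)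
  finally show ?thesis
    by (simp add: f_def g_def card_Compl_finite mult_ac)
qed

end
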